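(* Let $d>1$ be an integer and, for each positive integer $n$, let $a_n = 2^{2^n}+d$. Then for every positive integer $m$ there exist two distinct positive integers $k \neq l$ such that $\gcd(a_k,a_l) > m$. *)

theory Defs
  imports Complex_Main
begin

end

(* Say that a modulus q is k-admissible if the order of 2 modulo q is a 2-power at most 2^k times
   an odd number. If such a q divides a_k, then, with u the odd part of the order, q also divides
   a_l for l = k + totient u. So bounded gcds force every k-admissible divisor of a_k to be bounded.
   Write d = 2^j d' with d' odd, so that for large k the odd part of a_k is b = 2^(2^k - j) + d'.
   Collecting the prime factors p of b according to whether 2^(k+1) divides p - 1 gives b = s r
   with s k-admissible and r = 1 (mod 2^(k+1)); as s is bounded and s = d' (mod 2^(k+1)), it follows
   that s = d' for large k, so that d' divides a power of 2 and d' = 1. But then j > 0, and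
   b = 2^(2^k - j) + 1 is itself k-admissible and unbounded. *)
theory Submission
  imports Defs "HOL-Number_Theory.Number_Theory"
begin

text \<open>Any odd multiple of the odd part of the order of 2 may serve as \<open>u\<close>, so
  witnesses for two moduli can simply be multiplied.\<close>

definition admissible :: "nat \<Rightarrow> nat \<Rightarrow> bool" where
  "admissible k q \<longleftrightarrow> (\<exists>u. odd u \<and> [2 ^ (2 ^ k * u) = 1] (mod q))"

lemma admissible_recurrence:
  assumes "admissible k q"
  obtains l where "l > k" "[2 ^ 2 ^ l = 2 ^ 2 ^ k] (mod q)"
proof -
  from assms obtain u where u: "odd u" "[2 ^ (2 ^ k * u) = 1] (mod q)"
    unfolding admissible_def by blast
  have "[2 ^ totient u = 1] (mod u)"
    using u(1) by (intro euler_theorem) simp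
  moreover have "(1::nat) \<le> 2 ^ totient u" by simp
  ultimately have "u dvd 2 ^ totient u - 1"
    using cong_altdef_nat by blast
  then obtain t where "2 ^ totient u - 1 = u * t" ..
  then have t: "2 ^ totient u = 1 + u * t"
    using \<open>1 \<le> 2 ^ totient u\<close> by linarith
  \<comment> \<open>The exponent is \<open>2 ^ k * (1 + u * t)\<close>, and its part
    \<open>2 ^ k * u * t\<close> contributes 1 modulo \<open>q\<close>.\<close>
  have "(2::nat) ^ 2 ^ (k + totient u) = 2 ^ 2 ^ k * (2 ^ (2 ^ k * u)) ^ t"
    by (simp add: power_add t distrib_left mult.assoc flip: power_mult)
  also have "[\<dots> = 2 ^ 2 ^ k * 1 ^ t] (mod q)"
    by (intro cong_mult cong_pow u(2) cong_refl)
  finally have "[2 ^ 2 ^ (k + totient u) = 2 ^ 2 ^ k] (mod q)" by simp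
  moreover have "totient u > 0" using u(1) by (simp add: odd_pos)
  ultimately show thesis using that[of "k + totient u"] by simp
qed

text \<open>In x^q - 1 = (x - 1)(1 + x + ... + x^(q-1)), \<open>r\<close> divides the first factor,
  and the second is a sum of \<open>q\<close> terms congruent to 1 modulo \<open>q\<close>. Common
  factors of \<open>q\<close> and \<open>r\<close> are allowed, so repeated primes can be
  handled.\<close>

lemma cong_1_pow_mult_modulus:
  fixes x q r :: nat
  assumes "[x = 1] (mod q)" "[x = 1] (mod r)"
  shows "[x ^ q = 1] (mod (q * r))"
proof -
  have q: "[int x = 1] (mod int q)" and r: "[int x = 1] (mod int r)"
    using assms by (simp_all flip: cong_int_iff)
  have "[(\<Sum>i<q. int x ^ i) = (\<Sum>i<q. 1 ^ i)] (mod int q)"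
    by (intro cong_sum cong_pow q)
  then have "int q dvd (\<Sum>i<q. int x ^ i)"
    by (simp add: cong_dvd_iff cong_0_iff)
  moreover have "int r dvd int x - 1"
    using r by (simp add: cong_iff_dvd_diff)
  ultimately have "int q * int r dvd int x ^ q - 1"
    by (simp add: power_diff_1_eq mult.commute[of "int q"] mult_dvd_mono)
  then have "[int (x ^ q) = int 1] (mod int (q * r))"
    by (simp add: cong_iff_dvd_diff)
  then show ?thesis by (simp only: cong_int_iff)
qed

text \<open>Raising to the power \<open>q\<close> passes to the modulus \<open>q * r\<close>; as
  \<open>q\<close> is odd, the multiplier \<open>u * v * q\<close> stays odd.\<close>

lemma admissible_mult:
  assumes "admissible k q" "admissible k r" "odd q"
  shows "admissible k (q * r)"
proof -
  from assms obtain u v where u: "odd u" "[2 ^ (2 ^ k * u) = 1] (mod q)"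
    and v: "odd v" "[2 ^ (2 ^ k * v) = 1] (mod r)"
    unfolding admissible_def by blast
  have "[2 ^ (2 ^ k * (u * v)) = 1] (mod q)"
    using cong_pow[OF u(2), of v] by (simp add: mult.assoc flip: power_mult)
  moreover have "[2 ^ (2 ^ k * (u * v)) = 1] (mod r)"
    using cong_pow[OF v(2), of u] by (simp add: ac_simps flip: power_mult)
  ultimately have "[(2 ^ (2 ^ k * (u * v))) ^ q = 1] (mod (q * r))"
    by (rule cong_1_pow_mult_modulus)
  then have "[2 ^ (2 ^ k * (u * v * q)) = 1] (mod (q * r))"
    by (simp add: ac_simps flip: power_mult)
  moreover have "odd (u * v * q)" using u v assms by simp
  ultimately show ?thesis unfolding admissible_def by blast
qed

lemma admissible_of_cong_1:
  assumes "[2 ^ n = 1] (mod q)" "n > 0" "\<not> 2 ^ Suc k dvd n"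
  shows "admissible k q"
proof -
  from \<open>n > 0\<close> obtain u where u: "n = 2 ^ multiplicity 2 n * u" "odd u"
    using multiplicity_decompose'[of n 2] by auto
  have "multiplicity 2 n \<le> k"
    using assms(3) multiplicity_dvd'[of "Suc k" 2 n] by (meson not_less_eq_eq)
  then have "2 ^ k * u = n * 2 ^ (k - multiplicity 2 n)"
    by (subst u(1)) (simp add: ac_simps flip: power_add)
  then have "[2 ^ (2 ^ k * u) = 1] (mod q)"
    using cong_pow[OF assms(1), of "2 ^ (k - multiplicity 2 n)"] by (simp add: power_mult)
  with u(2) show ?thesis unfolding admissible_def by blast
qed

lemma admissible_decomposition:
  fixes b :: nat
  assumes "odd b"
  shows "\<exists>s r. b = s * r \<and> admissible k s \<and> [r = 1] (mod 2 ^ Suc k)"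
  using assms
proof (induction b rule: prime_divisors_induct)
  case zero
  then show ?case by simp
next
  case (unit x)
  have "admissible k 1" unfolding admissible_def by (auto intro!: exI[of _ 1])
  with unit show ?case by (intro exI[of _ 1]) auto
next
  case (factor p x)
  then have odd: "odd p" "odd x" by auto
  with factor obtain s r where sr: "x = s * r" "admissible k s" "[r = 1] (mod 2 ^ Suc k)"
    by blast
  have "p > 1" using factor(1) by (rule prime_gt_1_nat)
  show ?case
  proof (cases "2 ^ Suc k dvd p - 1")
    case True
    then have "[p = 1] (mod 2 ^ Suc k)"
      using \<open>p > 1\<close> by (subst cong_altdef_nat) auto
    then have "[p * r = 1 * 1] (mod 2 ^ Suc k)" using sr(3) by (rule cong_mult)
    then show ?thesis using sr by (intro exI[of _ s] exI[of _ "p * r"]) auto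
  next
    case False
    \<comment> \<open>Fermat gives the exponent \<open>p - 1\<close>, which is not divisible by
      \<open>2 ^ Suc k\<close> in this case.\<close>
    have "coprime 2 p" using odd by simp
    then have "[2 ^ (p - 1) = 1] (mod p)"
      using euler_theorem[of 2 p] factor(1) by (simp add: totient_prime)
    then have "admissible k p"
      using False \<open>p > 1\<close> by (intro admissible_of_cong_1) auto
    then have "admissible k (p * s)" using sr(2) odd by (intro admissible_mult)
    then show ?thesis using sr by (intro exI[of _ "p * s"] exI[of _ r]) auto
  qed
qed

lemma admissible_two_power_plus_1:
  assumes "0 < j" "j < 2 ^ k"
  shows "admissible k (2 ^ (2 ^ k - j) + 1)"
proof (rule admissible_of_cong_1)
  let ?x = "(2::nat) ^ (2 ^ k - j)"
  have "?x ^ 2 - 1 = (?x + 1) * (?x - 1)"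
    by (simp add: power2_eq_square algebra_simps diff_mult_distrib2)
  then have "?x + 1 dvd 2 ^ (2 * (2 ^ k - j)) - 1"
    by (metis dvd_triv_left mult.commute power_mult)
  then show "[2 ^ (2 * (2 ^ k - j)) = 1] (mod (?x + 1))"
    by (subst cong_altdef_nat) auto
  show "2 * (2 ^ k - j) > 0" using assms by simp
  \<comment> \<open>Since \<open>j > 0\<close>, the exponent is positive and strictly below
    \<open>2 ^ Suc k\<close>.\<close>
  show "\<not> 2 ^ Suc k dvd 2 * (2 ^ k - j)"
    using assms by (auto dest: dvd_imp_le)
qed

lemma gcd_unbounded:
  fixes d m :: nat
  assumes "d > 1"
  shows "\<exists>k l. 0 < k \<and> k < l \<and> gcd (2 ^ 2 ^ k + d) (2 ^ 2 ^ l + d) > m"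
proof (rule ccontr)
  assume "\<not> ?thesis"
  then have bounded: "gcd (2 ^ 2 ^ k + d) (2 ^ 2 ^ l + d) \<le> m" if "0 < k" "k < l" for k l
    using that by (meson not_le)
  have small: "q \<le> m" if "0 < k" "admissible k q" "q dvd 2 ^ 2 ^ k + d" for k q
  proof -
    from \<open>admissible k q\<close> obtain l where l: "l > k" "[2 ^ 2 ^ l = 2 ^ 2 ^ k] (mod q)"
      by (rule admissible_recurrence)
    have "[2 ^ 2 ^ l + d = 2 ^ 2 ^ k + d] (mod q)"
      using l(2) by (intro cong_add cong_refl)
    then have "q dvd gcd (2 ^ 2 ^ k + d) (2 ^ 2 ^ l + d)"
      using that(3) by (simp add: cong_dvd_iff)
    then have "q \<le> gcd (2 ^ 2 ^ k + d) (2 ^ 2 ^ l + d)"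
      using assms by (intro dvd_imp_le) auto
    with bounded[OF \<open>0 < k\<close> l(1)] show ?thesis by simp
  qed
  from assms obtain c where c: "d = 2 ^ multiplicity 2 d * c" "odd c"
    using multiplicity_decompose'[of d 2] by auto
  define j where "j = multiplicity 2 d"
  \<comment> \<open>Large enough that \<open>2 ^ Suc k\<close> exceeds \<open>m + d\<close> and
    divides \<open>2 ^ (2 ^ k - j)\<close>, and that \<open>m < 2 ^ k - j\<close>.\<close>
  define k where "k = m + d + j + 2"
  have "k \<ge> 3" using assms by (simp add: k_def)
  then have k2: "2 * k + 2 \<le> 2 ^ k"
    by (induction k rule: dec_induct) auto
  then have k: "0 < k" "Suc k \<le> 2 ^ k - j" "j < 2 ^ k"
    by (auto simp: k_def)
  define b where "b = 2 ^ (2 ^ k - j) + c"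
  have "2 ^ 2 ^ k + d = 2 ^ j * b"
    using k c by (simp add: b_def j_def distrib_left flip: power_add)
  then have b_dvd: "b dvd 2 ^ 2 ^ k + d" by simp
  have "odd b" using c k by (auto simp: b_def)
  then obtain s r where sr: "b = s * r" "admissible k s" "[r = 1] (mod 2 ^ Suc k)"
    using admissible_decomposition by blast
  have "[s * 1 = s * r] (mod 2 ^ Suc k)"
    using sr(3) by (intro cong_mult cong_refl) (rule cong_sym)
  also have "s * r = b" using sr(1) by simp
  also have "[b = 0 + c] (mod 2 ^ Suc k)"
    unfolding b_def using le_imp_power_dvd[OF k(2), of 2]
    by (intro cong_add cong_refl) (simp only: cong_0_iff)
  finally have "[s = c] (mod 2 ^ Suc k)" by simp
  moreover have "s \<le> m"
    using sr b_dvd by (intro small[OF k(1)]) auto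
  moreover have "c \<le> d" using c(1) assms by (intro dvd_imp_le) (metis dvd_triv_right, simp)
  moreover have "m + d < 2 ^ Suc k"
    using k2 by (simp add: k_def)
  \<comment> \<open>Both residues lie below the modulus, so the congruence is an equality; then
    \<open>c\<close> divides \<open>b\<close> and hence \<open>b - c\<close>, a power of 2.\<close>
  ultimately have "s = c"
    by (intro cong_less_modulus_unique_nat) auto
  then have "c dvd 2 ^ (2 ^ k - j)"
    using sr(1) by (metis b_def dvd_add_left_iff dvd_refl dvd_triv_left)
  moreover have "coprime c (2 ^ (2 ^ k - j))" using c(2) by simp
  ultimately have "c = 1"
    by (metis coprime_common_divisor dvd_refl nat_dvd_1_iff_1)
  \<comment> \<open>Here \<open>d = 2 ^ j\<close>, so \<open>j = 0\<close> would contradict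
    \<open>d > 1\<close>.\<close>
  have "j > 0" using c(1) \<open>c = 1\<close> assms by (cases j) (auto simp: j_def)
  then have "admissible k b"
    unfolding b_def \<open>c = 1\<close> using k by (intro admissible_two_power_plus_1)
  then have "b \<le> m" using b_dvd by (intro small[OF k(1)])
  moreover have "2 ^ k - j < b"
    unfolding b_def using less_exp[of "2 ^ k - j"] by linarith
  ultimately show False using k(2) by (simp add: k_def)
qed

theorem theorem1:
  fixes d :: int and a :: "nat \<Rightarrow> int"
  assumes "d > 1"
    and "\<And>n. n > 0 \<Longrightarrow> a n = 2 ^ (2 ^ n) + d"
  shows "\<forall>m::int. m > 0 \<longrightarrow>
           (\<exists>k l. k > 0 \<and> l > 0 \<and> k \<noteq> l \<and> gcd (a k) (a l) > m)"
proof (intro allI impI)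
  fix m :: int
  assume "m > 0"
  have a: "a n = int (2 ^ 2 ^ n + nat d)" if "n > 0" for n
    using assms that by simp
  obtain k l where kl: "0 < k" "k < l" "gcd (2 ^ 2 ^ k + nat d) (2 ^ 2 ^ l + nat d) > nat m"
    using gcd_unbounded[of "nat d" "nat m"] assms(1) by auto
  then have "gcd (a k) (a l) > m"
    unfolding a[OF kl(1)] a[OF order.strict_trans[OF kl(1,2)]] gcd_int_int_eq
    by linarith
  with kl show "\<exists>k l. k > 0 \<and> l > 0 \<and> k \<noteq> l \<and> gcd (a k) (a l) > m"
    by (intro exI[of _ k] exI[of _ l]) auto
qed

end
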